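(* Let $\alpha>0$ and let $k$ be a positive integer. Assume $\{\phi_i\}_{i=1}^k\in\mathcal A_k$ is not fixed by the rearrangement algorithm. Then one iteration of the rearrangement algorithm results in a strict decrease in $\Lambda_k^\alpha$: if $\{\phi_i^+\}_{i=1}^k$ denotes the next iterate, then $$\Lambda_k^\alpha(\{\phi_i^+\}_{i=1}^k)<\Lambda_k^\alpha(\{\phi_i\}_{i=1}^k).$$
   Context: $G=(V,E)$ is a finite undirected graph with non-negative edge weights $w_{ij}=w_{ji}\ge 0$ (with $w_{ij}=0$ if $(i,j)\notin E$). Degrees are $d_i=\sum_j w_{ij}$, and $r\in[0,1]$ is a fixed parameter. For $\psi:V\to\mathbb R$ put $$\|\nabla\psi\|_{w,E}^2=\sum_{(i,j)\in E}w_{ij}(\psi_i-\psi_j)^2,\qquad \|\psi\|^2=\|\psi\|_V^2=\sum_{i\in V}d_i^r\psi_i^2,$$ and, for $f:V\to[0,\infty)$, $\|\psi\|_f^2=\sum_{i\in V}d_i^r f_i\psi_i^2$. For $\alpha>0$ and $\phi:V\to[0,1]$ define $$\lambda^\alpha(\phi)=\inf_{\|\psi\|=1}\ \|\nabla\psi\|_{w,E}^2+\alpha\|\psi\|^2_{(1-\phi)}.$$ This is the first eigenvalue of the operator $\Delta_r+\alpha(1-\phi)$, where $\Delta_r=D^{-r}(D-W)$, $D=\mathrm{diag}(d)$, $W=(w_{ij})$. The minimizer is unique up to scaling and can be chosen strictly positive; throughout, the eigenfunction corresponding to $\lambda^\alpha(\phi)$ is taken to be positive with $\|\psi\|_V=1$.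 The admissible class is $$\mathcal A_k=\Big\{\{\phi_i\}_{i=1}^k:\ \phi_i:V\to[0,1],\ \sum_{i=1}^k\phi_i=1\Big\},$$ and the relaxed energy is $\Lambda_k^\alpha(\{\phi_i\}_{i=1}^k)=\sum_{i=1}^k\lambda^\alpha(\phi_i)$. Rearrangement algorithm (one iteration): given $\{\phi_i\}_{i=1}^k\in\mathcal A_k$, (1) for $i=1,\dots,k$ compute the positive normalized eigenfunction $\psi_i$ corresponding to $\lambda^\alpha(\phi_i)$; (2) assign each node $v\in V$ the label $i=\arg\max_j\psi_j(v)$; (3) let the new $\{\phi_i\}_{i=1}^k$ be the indicator functions for the labels. A collection is fixed by the algorithm if an iteration leaves it unchanged.
   Formalization: Excluded: all φ_i and all φ_i^+ constant on V. There Λ=α(k−1) before and after, so strict decrease fails (e.g. k=2, φ_1=φ_2=1/2, ties to label 1). Argmax ties may be broken by any rule; the graph is connected, as uniqueness of the minimizer requires. *)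

theory Defs
  imports Complex_Main "HOL-Library.Indicator_Function"
begin

text \<open>
  The vertex set is a finite type. An undirected edge set is a symmetric relation, so it contains
  both orientations of every edge.
\<close>

definition weighted_graph :: "('v::finite \<times> 'v) set \<Rightarrow> ('v \<Rightarrow> 'v \<Rightarrow> real) \<Rightarrow> bool" where
  "weighted_graph E w \<longleftrightarrow>
     sym E \<and> (\<forall>i j. w i j = w j i) \<and> (\<forall>i j. 0 \<le> w i j) \<and> (\<forall>i j. (i, j) \<notin> E \<longrightarrow> w i j = 0)"

text \<open>
  Edges may have weight zero, so connectedness is required of the edges of positive weight. This is
  what makes the first eigenfunction simple and positive for every \<open>\<phi>\<close>.
\<close>

definition weight_connected :: "('v::finite \<Rightarrow> 'v \<Rightarrow> real) \<Rightarrow> bool" where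
  "weight_connected w \<longleftrightarrow> (\<forall>u v. (u, v) \<in> {(i, j). 0 < w i j}\<^sup>*)"

definition wdegree :: "('v::finite \<Rightarrow> 'v \<Rightarrow> real) \<Rightarrow> 'v \<Rightarrow> real" where
  "wdegree w i = (\<Sum>j\<in>UNIV. w i j)"

text \<open>
  The factor 1/2 makes every undirected edge count once. This is the normalization under which
  \<open>grad_norm_sq\<close> is the quadratic form of \<open>laplacian\<close> below.
\<close>

definition grad_norm_sq ::
  "('v::finite \<times> 'v) set \<Rightarrow> ('v \<Rightarrow> 'v \<Rightarrow> real) \<Rightarrow> ('v \<Rightarrow> real) \<Rightarrow> real" where
  "grad_norm_sq E w \<psi> = (\<Sum>(i, j)\<in>E. w i j * (\<psi> i - \<psi> j)\<^sup>2) / 2"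

definition vnorm_sq ::
  "('v::finite \<Rightarrow> 'v \<Rightarrow> real) \<Rightarrow> real \<Rightarrow> ('v \<Rightarrow> real) \<Rightarrow> real" where
  "vnorm_sq w r \<psi> = (\<Sum>i\<in>UNIV. wdegree w i powr r * (\<psi> i)\<^sup>2)"

definition weighted_vnorm_sq ::
  "('v::finite \<Rightarrow> 'v \<Rightarrow> real) \<Rightarrow> real \<Rightarrow> ('v \<Rightarrow> real) \<Rightarrow> ('v \<Rightarrow> real) \<Rightarrow> real" where
  "weighted_vnorm_sq w r f \<psi> = (\<Sum>i\<in>UNIV. wdegree w i powr r * f i * (\<psi> i)\<^sup>2)"

definition first_eigenvalue ::
  "('v::finite \<times> 'v) set \<Rightarrow> ('v \<Rightarrow> 'v \<Rightarrow> real) \<Rightarrow> real \<Rightarrow> real \<Rightarrow> ('v \<Rightarrow> real) \<Rightarrow> real" where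
  "first_eigenvalue E w r \<alpha> \<phi> =
     (INF \<psi>\<in>{\<psi>. vnorm_sq w r \<psi> = 1}.
        grad_norm_sq E w \<psi> + \<alpha> * weighted_vnorm_sq w r (\<lambda>i. 1 - \<phi> i) \<psi>)"

definition laplacian ::
  "('v::finite \<Rightarrow> 'v \<Rightarrow> real) \<Rightarrow> real \<Rightarrow> ('v \<Rightarrow> real) \<Rightarrow> 'v \<Rightarrow> real" where
  "laplacian w r \<psi> i = wdegree w i powr (- r) * (wdegree w i * \<psi> i - (\<Sum>j\<in>UNIV. w i j * \<psi> j))"

definition is_first_eigenfunction ::
  "('v::finite \<times> 'v) set \<Rightarrow> ('v \<Rightarrow> 'v \<Rightarrow> real) \<Rightarrow> real \<Rightarrow> real \<Rightarrow> ('v \<Rightarrow> real) \<Rightarrow> ('v \<Rightarrow> real) \<Rightarrow> bool"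
  where
  "is_first_eigenfunction E w r \<alpha> \<phi> \<psi> \<longleftrightarrow>
     (\<forall>i. laplacian w r \<psi> i + \<alpha> * (1 - \<phi> i) * \<psi> i = first_eigenvalue E w r \<alpha> \<phi> * \<psi> i) \<and>
     (\<forall>i. 0 < \<psi> i) \<and> vnorm_sq w r \<psi> = 1"

definition first_eigenfunction ::
  "('v::finite \<times> 'v) set \<Rightarrow> ('v \<Rightarrow> 'v \<Rightarrow> real) \<Rightarrow> real \<Rightarrow> real \<Rightarrow> ('v \<Rightarrow> real) \<Rightarrow> 'v \<Rightarrow> real" where
  "first_eigenfunction E w r \<alpha> \<phi> = (THE \<psi>. is_first_eigenfunction E w r \<alpha> \<phi> \<psi>)"

text \<open>A collection \<open>{\<phi>\<^sub>i}\<close> is a function of which only the values at indices in \<open>{1..k}\<close> matter.\<close>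

definition admissible :: "nat \<Rightarrow> (nat \<Rightarrow> 'v::finite \<Rightarrow> real) \<Rightarrow> bool" where
  "admissible k \<phi> \<longleftrightarrow>
     (\<forall>i\<in>{1..k}. \<forall>v. 0 \<le> \<phi> i v \<and> \<phi> i v \<le> 1) \<and> (\<forall>v. (\<Sum>i=1..k. \<phi> i v) = 1)"

definition relaxed_energy ::
  "('v::finite \<times> 'v) set \<Rightarrow> ('v \<Rightarrow> 'v \<Rightarrow> real) \<Rightarrow> real \<Rightarrow> real \<Rightarrow> nat \<Rightarrow> (nat \<Rightarrow> 'v \<Rightarrow> real) \<Rightarrow> real"
  where
  "relaxed_energy E w r \<alpha> k \<phi> = (\<Sum>i=1..k. first_eigenvalue E w r \<alpha> (\<phi> i))"

text \<open>
  The maximizing index at a vertex need not be unique. A tie-breaking rule selects, at each vertex,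
  one element from the set of maximizers.
\<close>

definition tie_breaking :: "('v \<Rightarrow> nat set \<Rightarrow> nat) \<Rightarrow> bool" where
  "tie_breaking \<tau> \<longleftrightarrow> (\<forall>v S. S \<noteq> {} \<longrightarrow> \<tau> v S \<in> S)"

definition rearrangement_label ::
  "('v::finite \<times> 'v) set \<Rightarrow> ('v \<Rightarrow> 'v \<Rightarrow> real) \<Rightarrow> real \<Rightarrow> real \<Rightarrow> nat \<Rightarrow> ('v \<Rightarrow> nat set \<Rightarrow> nat) \<Rightarrow>
     (nat \<Rightarrow> 'v \<Rightarrow> real) \<Rightarrow> 'v \<Rightarrow> nat" where
  "rearrangement_label E w r \<alpha> k \<tau> \<phi> v =
     \<tau> v {i. is_arg_max (\<lambda>j. first_eigenfunction E w r \<alpha> (\<phi> j) v) (\<lambda>j. j \<in> {1..k}) i}"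

definition rearrangement ::
  "('v::finite \<times> 'v) set \<Rightarrow> ('v \<Rightarrow> 'v \<Rightarrow> real) \<Rightarrow> real \<Rightarrow> real \<Rightarrow> nat \<Rightarrow> ('v \<Rightarrow> nat set \<Rightarrow> nat) \<Rightarrow>
     (nat \<Rightarrow> 'v \<Rightarrow> real) \<Rightarrow> nat \<Rightarrow> 'v \<Rightarrow> real" where
  "rearrangement E w r \<alpha> k \<tau> \<phi> i = indicator {v. rearrangement_label E w r \<alpha> k \<tau> \<phi> v = i}"

definition fixed_by_rearrangement ::
  "('v::finite \<times> 'v) set \<Rightarrow> ('v \<Rightarrow> 'v \<Rightarrow> real) \<Rightarrow> real \<Rightarrow> real \<Rightarrow> nat \<Rightarrow> ('v \<Rightarrow> nat set \<Rightarrow> nat) \<Rightarrow>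
     (nat \<Rightarrow> 'v \<Rightarrow> real) \<Rightarrow> bool" where
  "fixed_by_rearrangement E w r \<alpha> k \<tau> \<phi> \<longleftrightarrow>
     (\<forall>i\<in>{1..k}. rearrangement E w r \<alpha> k \<tau> \<phi> i = \<phi> i)"

definition all_constant :: "nat \<Rightarrow> (nat \<Rightarrow> 'v \<Rightarrow> real) \<Rightarrow> bool" where
  "all_constant k \<phi> \<longleftrightarrow> (\<forall>i\<in>{1..k}. \<forall>u v. \<phi> i u = \<phi> i v)"

text \<open>
  If every \<open>\<phi>\<^sub>i\<close> is constant, then all eigenfunctions are the same constant and every vertex is a
  \<open>k\<close>-way tie. When the tie-breaking rule then gives all vertices the same label, the energy is
  \<open>\<alpha> * (k - 1)\<close> before and after the iteration, so there is no strict decrease (for instance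
  \<open>k = 2\<close>, \<open>\<phi>\<^sub>1 = \<phi>\<^sub>2 = 1/2\<close>, ties resolved to the smaller label). The following predicate describes
  exactly this situation. It cannot occur for a collection that is not fixed when the maximizing
  labels are unique.
\<close>

definition degenerate_tie ::
  "('v::finite \<times> 'v) set \<Rightarrow> ('v \<Rightarrow> 'v \<Rightarrow> real) \<Rightarrow> real \<Rightarrow> real \<Rightarrow> nat \<Rightarrow> ('v \<Rightarrow> nat set \<Rightarrow> nat) \<Rightarrow>
     (nat \<Rightarrow> 'v \<Rightarrow> real) \<Rightarrow> bool" where
  "degenerate_tie E w r \<alpha> k \<tau> \<phi> \<longleftrightarrow>
     all_constant k \<phi> \<and> all_constant k (rearrangement E w r \<alpha> k \<tau> \<phi>)"

end

theory Submission
  imports Defs "HOL-Analysis.Analysis"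
begin

text \<open>
  Testing \<open>\<lambda>\<^sup>\<alpha>(\<phi>\<^sub>i\<^sup>+)\<close> with the old eigenfunction \<open>\<psi>\<^sub>i\<close> and summing over \<open>i\<close> bounds the new energy by
  the old energy plus \<open>\<alpha> \<Sum>\<^sub>v d\<^sub>v\<^sup>r \<Sum>\<^sub>i (\<phi>\<^sub>i(v) - \<phi>\<^sub>i\<^sup>+(v)) \<psi>\<^sub>i(v)\<^sup>2\<close>, which is nonpositive because
  \<open>\<phi>\<^sup>+\<close> puts all its mass on a largest \<open>\<psi>\<^sub>i(v)\<close>. In case of equality every \<open>\<psi>\<^sub>i\<close> is also a minimizer
  for \<open>\<phi>\<^sub>i\<^sup>+\<close>, so it satisfies both eigenvalue equations, and their difference shows that
  \<open>\<phi>\<^sub>i - \<phi>\<^sub>i\<^sup>+\<close> is a constant \<open>c\<^sub>i\<close>. These constants sum to zero. If one of them is nonzero, then some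
  \<open>c\<^sub>j\<close> is negative, which forces \<open>\<phi>\<^sub>j\<^sup>+ = 1\<close> everywhere; then all \<open>\<phi>\<^sub>i\<^sup>+\<close>, and hence all \<open>\<phi>\<^sub>i\<close>, are
  constant, which is the excluded degenerate tie.
\<close>

text \<open>For small \<open>t\<close> the linear term dominates and changes sign with
  \<open>t\<close>. This turns minimality into the vanishing of a first variation in
  \<open>minimizer_imp_eigenvector\<close>.\<close>

lemma quadratic_nonneg_imp_linear_zero:
  fixes a b :: real
  assumes "\<And>t. 0 \<le> 2 * t * b + t\<^sup>2 * a"
  shows "b = 0"
proof (rule ccontr)
  assume "b \<noteq> 0"
  \<comment> \<open>The added 1 keeps \<open>c\<close> positive and gives \<open>a < c\<close>, so
    the value at \<open>- b / c\<close> is negative whatever the sign of \<open>a\<close>.\<close>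
  define c where "c = \<bar>a\<bar> + 1"
  have "c > 0" by (simp add: c_def)
  have "2 * (- b / c) * b + (- b / c)\<^sup>2 * a = b\<^sup>2 / c * (a / c - 2)"
    using \<open>c > 0\<close> by (simp add: field_simps power2_eq_square)
  moreover have "a / c - 2 < 0"
    using \<open>c > 0\<close> by (simp add: field_simps c_def)
  moreover have "b\<^sup>2 / c > 0"
    using \<open>b \<noteq> 0\<close> \<open>c > 0\<close> by simp
  ultimately have "2 * (- b / c) * b + (- b / c)\<^sup>2 * a < 0"
    by (metis mult_pos_neg)
  with assms[of "- b / c"] show False by linarith
qed

text \<open>A path from \<open>i\<close> to a different vertex must leave \<open>i\<close> along an
  edge of positive weight.\<close>

lemma wdegree_pos:
  fixes w :: "'v::finite \<Rightarrow> 'v \<Rightarrow> real"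
  assumes "weighted_graph E w" and "weight_connected w" and "(u::'v) \<noteq> v"
  shows "0 < wdegree w i"
proof -
  obtain x where "x \<noteq> i" using assms(3) by metis
  moreover have "(i, x) \<in> {(i, j). 0 < w i j}\<^sup>*"
    using assms(2) by (simp add: weight_connected_def)
  ultimately obtain j where "0 < w i j"
    by (auto elim: converse_rtranclE)
  then show ?thesis
    using assms(1) unfolding wdegree_def weighted_graph_def
    by (intro sum_pos2[of _ j]) auto
qed

text \<open>Positive degrees make every vertex weight \<open>wdegree w i powr r\<close> positive, so
  that \<open>vnorm_sq\<close> is definite and the factor \<open>wdegree w i powr (- r)\<close> in
  \<open>laplacian\<close> can be cancelled.\<close>

locale positive_degree_graph =
  fixes E :: "('v::finite \<times> 'v) set" and w :: "'v \<Rightarrow> 'v \<Rightarrow> real" and r \<alpha> :: real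
  assumes graph: "weighted_graph E w" and connected: "weight_connected w"
    and degree_pos: "\<And>i. 0 < wdegree w i"
begin

section \<open>The quadratic form, its first variation and the norm\<close>

lemma w_sym: "w i j = w j i" and w_nonneg: "0 \<le> w i j" and w_outside: "(i, j) \<notin> E \<Longrightarrow> w i j = 0"
  using graph by (auto simp: weighted_graph_def)

text \<open>The form is not divided by \<open>vnorm_sq\<close>, so it is homogeneous of degree two
  and defined at the zero function as well.\<close>

definition rayleigh :: "('v \<Rightarrow> real) \<Rightarrow> ('v \<Rightarrow> real) \<Rightarrow> real" where
  "rayleigh \<phi> \<psi> = grad_norm_sq E w \<psi> + \<alpha> * weighted_vnorm_sq w r (\<lambda>i. 1 - \<phi> i) \<psi>"

abbreviation mass :: "'v \<Rightarrow> real" where "mass i \<equiv> wdegree w i powr r"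

abbreviation schroedinger :: "('v \<Rightarrow> real) \<Rightarrow> ('v \<Rightarrow> real) \<Rightarrow> 'v \<Rightarrow> real" where
  "schroedinger \<phi> \<psi> i \<equiv> laplacian w r \<psi> i + \<alpha> * (1 - \<phi> i) * \<psi> i"

lemma mass_pos: "0 < mass i"
  using degree_pos[of i] by simp

lemma first_eigenvalue_eq_INF:
  "first_eigenvalue E w r \<alpha> \<phi> = (INF \<psi>\<in>{\<psi>. vnorm_sq w r \<psi> = 1}. rayleigh \<phi> \<psi>)"
  by (simp add: first_eigenvalue_def rayleigh_def)

lemma grad_norm_sq_alt: "grad_norm_sq E w \<psi> = (\<Sum>i\<in>UNIV. \<Sum>j\<in>UNIV. w i j * (\<psi> i - \<psi> j)\<^sup>2) / 2"
proof -
  have "(\<Sum>(i, j)\<in>E. w i j * (\<psi> i - \<psi> j)\<^sup>2) = (\<Sum>(i, j)\<in>UNIV. w i j * (\<psi> i - \<psi> j)\<^sup>2)"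
    by (rule sum.mono_neutral_left) (auto simp: w_outside)
  then show ?thesis
    by (simp add: grad_norm_sq_def sum.cartesian_product)
qed

text \<open>Summation by parts: since \<open>w\<close> is symmetric, exchanging \<open>i\<close> and
  \<open>j\<close> shows that the terms with \<open>\<eta> j\<close> contribute as much as those
  with \<open>\<eta> i\<close>, which cancels the factor 1/2.\<close>

lemma green_identity:
  "(\<Sum>i\<in>UNIV. \<Sum>j\<in>UNIV. w i j * ((\<psi> i - \<psi> j) * (\<eta> i - \<eta> j))) / 2
     = (\<Sum>i\<in>UNIV. mass i * laplacian w r \<psi> i * \<eta> i)"
proof -
  have lap: "mass i * laplacian w r \<psi> i * \<eta> i = (\<Sum>j\<in>UNIV. w i j * ((\<psi> i - \<psi> j) * \<eta> i))" for i
  proof -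
    have "mass i * laplacian w r \<psi> i = wdegree w i * \<psi> i - (\<Sum>j\<in>UNIV. w i j * \<psi> j)"
      using degree_pos[of i] by (simp add: laplacian_def powr_minus field_simps)
    also have "\<dots> = (\<Sum>j\<in>UNIV. w i j * (\<psi> i - \<psi> j))"
      by (simp add: wdegree_def sum_distrib_right sum_subtractf right_diff_distrib)
    finally show ?thesis
      by (simp add: sum_distrib_right mult.assoc)
  qed
  have "(\<Sum>i\<in>UNIV. \<Sum>j\<in>UNIV. w i j * ((\<psi> i - \<psi> j) * \<eta> j))
      = (\<Sum>i\<in>UNIV. \<Sum>j\<in>UNIV. w j i * ((\<psi> j - \<psi> i) * \<eta> i))"
    by (rule sum.swap)
  also have "\<dots> = (\<Sum>i\<in>UNIV. \<Sum>j\<in>UNIV. - (w i j * ((\<psi> i - \<psi> j) * \<eta> i)))"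
    by (intro sum.cong refl) (subst w_sym, simp add: algebra_simps)
  finally have "(\<Sum>i\<in>UNIV. \<Sum>j\<in>UNIV. w i j * ((\<psi> i - \<psi> j) * \<eta> j))
      = - (\<Sum>i\<in>UNIV. \<Sum>j\<in>UNIV. w i j * ((\<psi> i - \<psi> j) * \<eta> i))"
    by (simp add: sum_negf)
  then show ?thesis
    by (simp add: lap right_diff_distrib sum_subtractf)
qed

text \<open>The expansion is exact because the form is quadratic; \<open>green_identity\<close>
  converts its mixed gradient term into a pairing with the Laplacian. This links minimality to the
  eigenvalue equation.\<close>

lemma rayleigh_add:
  "rayleigh \<phi> (\<lambda>i. \<psi> i + t * \<eta> i) =
     rayleigh \<phi> \<psi> + 2 * t * (\<Sum>i\<in>UNIV. mass i * schroedinger \<phi> \<psi> i * \<eta> i) + t\<^sup>2 * rayleigh \<phi> \<eta>"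
proof -
  have "grad_norm_sq E w (\<lambda>i. \<psi> i + t * \<eta> i)
      = grad_norm_sq E w \<psi> + 2 * t * ((\<Sum>i\<in>UNIV. \<Sum>j\<in>UNIV. w i j * ((\<psi> i - \<psi> j) * (\<eta> i - \<eta> j))) / 2)
        + t\<^sup>2 * grad_norm_sq E w \<eta>"
    unfolding grad_norm_sq_alt
    unfolding sum_distrib_left sum_divide_distrib sum.distrib[symmetric]
    by (intro sum.cong refl) (simp add: power2_eq_square, simp add: algebra_simps)
  moreover have "weighted_vnorm_sq w r f (\<lambda>i. \<psi> i + t * \<eta> i)
      = weighted_vnorm_sq w r f \<psi> + 2 * t * (\<Sum>i\<in>UNIV. mass i * f i * \<psi> i * \<eta> i)
        + t\<^sup>2 * weighted_vnorm_sq w r f \<eta>" for f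
    unfolding weighted_vnorm_sq_def
    by (simp add: sum_distrib_left sum.distrib[symmetric])
      (intro sum.cong refl, simp add: algebra_simps power2_eq_square)
  moreover have "(\<Sum>i\<in>UNIV. mass i * schroedinger \<phi> \<psi> i * \<eta> i)
      = (\<Sum>i\<in>UNIV. mass i * laplacian w r \<psi> i * \<eta> i)
        + \<alpha> * (\<Sum>i\<in>UNIV. mass i * (1 - \<phi> i) * \<psi> i * \<eta> i)"
    unfolding sum_distrib_left sum.distrib[symmetric]
    by (intro sum.cong refl) (simp add: algebra_simps)
  ultimately show ?thesis
    unfolding rayleigh_def green_identity by (simp add: algebra_simps)
qed

lemma vnorm_sq_add:
  "vnorm_sq w r (\<lambda>i. \<psi> i + t * \<eta> i) =
     vnorm_sq w r \<psi> + 2 * t * (\<Sum>i\<in>UNIV. mass i * \<psi> i * \<eta> i) + t\<^sup>2 * vnorm_sq w r \<eta>"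
  unfolding vnorm_sq_def
  by (simp add: sum_distrib_left sum.distrib[symmetric])
    (intro sum.cong refl, simp add: algebra_simps power2_eq_square)

lemma rayleigh_zero: "rayleigh \<phi> (\<lambda>i. 0) = 0"
  by (simp add: rayleigh_def grad_norm_sq_def weighted_vnorm_sq_def)

lemma rayleigh_scale: "rayleigh \<phi> (\<lambda>i. t * \<psi> i) = t\<^sup>2 * rayleigh \<phi> \<psi>"
  using rayleigh_add[of \<phi> "\<lambda>i. 0" t \<psi>] by (simp add: rayleigh_zero laplacian_def)

lemma vnorm_sq_scale: "vnorm_sq w r (\<lambda>i. t * \<psi> i) = t\<^sup>2 * vnorm_sq w r \<psi>"
  by (simp add: vnorm_sq_def sum_distrib_left power_mult_distrib algebra_simps)

lemma vnorm_sq_nonneg: "0 \<le> vnorm_sq w r \<psi>"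
  by (simp add: vnorm_sq_def sum_nonneg)

lemma vnorm_sq_eq_0: "vnorm_sq w r \<psi> = 0 \<longleftrightarrow> \<psi> = (\<lambda>i. 0)"
proof -
  have "vnorm_sq w r \<psi> = 0 \<longleftrightarrow> (\<forall>i. mass i * (\<psi> i)\<^sup>2 = 0)"
    unfolding vnorm_sq_def by (subst sum_nonneg_eq_0_iff) auto
  then show ?thesis
    using mass_pos by (auto simp: fun_eq_iff less_le)
qed

section \<open>Existence of minimizers and the eigenvalue equation\<close>

lemma minimizer_exists:
  obtains \<psi> where "vnorm_sq w r \<psi> = 1"
    and "\<And>\<eta>. vnorm_sq w r \<eta> = 1 \<Longrightarrow> rayleigh \<phi> \<psi> \<le> rayleigh \<phi> \<eta>"
proof -
  \<comment> \<open>Functions become points of a Euclidean space, where the unit sphere of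
    \<open>vnorm_sq\<close> is closed and bounded, hence compact.\<close>
  define S :: "(real ^ 'v) set" where "S = {x. vnorm_sq w r (\<lambda>i. x $ i) = 1}"
  have "closed S"
    unfolding S_def vnorm_sq_def by (intro closed_Collect_eq continuous_intros)
  moreover have "bounded S"
  proof -
    have "\<bar>x $ i\<bar> \<le> sqrt (1 / mass i)" if "x \<in> S" for x i
    proof -
      have "mass i * (x $ i)\<^sup>2 \<le> (\<Sum>i\<in>UNIV. mass i * (x $ i)\<^sup>2)"
        by (rule member_le_sum) auto
      then have "(x $ i)\<^sup>2 \<le> 1 / mass i"
        using that mass_pos[of i] by (simp add: S_def vnorm_sq_def field_simps)
      then show ?thesis
        by (metis real_sqrt_abs real_sqrt_le_mono)
    qed
    then have "norm x \<le> (\<Sum>i\<in>UNIV. sqrt (1 / mass i))" if "x \<in> S" for x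
      using that by (intro order_trans[OF norm_le_l1_cart] sum_mono)
    then show ?thesis unfolding bounded_iff by blast
  qed
  ultimately have "compact S" by (simp add: compact_eq_bounded_closed)
  moreover have "S \<noteq> {}"
  proof -
    define c where "c = vnorm_sq w r (\<lambda>i. 1)"
    have "c > 0"
      using vnorm_sq_nonneg[of "\<lambda>i. 1"] vnorm_sq_eq_0[of "\<lambda>i. 1"]
      by (auto simp: c_def less_le fun_eq_iff)
    then have "vnorm_sq w r (\<lambda>i. (1 / sqrt c) * 1) = 1"
      unfolding vnorm_sq_scale by (simp add: c_def[symmetric] power_divide)
    then have "(\<chi> i. 1 / sqrt c) \<in> S" by (simp add: S_def vnorm_sq_def)
    then show ?thesis by blast
  qed
  moreover have "continuous_on S (\<lambda>x. rayleigh \<phi> (\<lambda>i. x $ i))"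
    unfolding rayleigh_def grad_norm_sq_alt weighted_vnorm_sq_def
    by (intro continuous_intros) auto
  ultimately obtain x where x: "x \<in> S"
    and min: "\<And>y. y \<in> S \<Longrightarrow> rayleigh \<phi> (\<lambda>i. x $ i) \<le> rayleigh \<phi> (\<lambda>i. y $ i)"
    using continuous_attains_inf[of S "\<lambda>x. rayleigh \<phi> (\<lambda>i. x $ i)"] by blast
  show ?thesis
  proof
    show "vnorm_sq w r (\<lambda>i. x $ i) = 1" using x by (simp add: S_def)
    fix \<eta> assume "vnorm_sq w r \<eta> = 1"
    then show "rayleigh \<phi> (\<lambda>i. x $ i) \<le> rayleigh \<phi> \<eta>"
      using min[of "\<chi> i. \<eta> i"]
      by (simp add: S_def rayleigh_def grad_norm_sq_def vnorm_sq_def weighted_vnorm_sq_def)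
  qed
qed

lemma first_eigenvalue_attained:
  obtains \<psi> where "vnorm_sq w r \<psi> = 1" and "rayleigh \<phi> \<psi> = first_eigenvalue E w r \<alpha> \<phi>"
    and "\<And>\<eta>. vnorm_sq w r \<eta> = 1 \<Longrightarrow> first_eigenvalue E w r \<alpha> \<phi> \<le> rayleigh \<phi> \<eta>"
proof -
  obtain \<psi> where \<psi>: "vnorm_sq w r \<psi> = 1"
    "\<And>\<eta>. vnorm_sq w r \<eta> = 1 \<Longrightarrow> rayleigh \<phi> \<psi> \<le> rayleigh \<phi> \<eta>"
    using minimizer_exists[where \<phi> = \<phi>] by blast
  then have "first_eigenvalue E w r \<alpha> \<phi> = rayleigh \<phi> \<psi>"
    unfolding first_eigenvalue_eq_INF by (intro cInf_eq_minimum) auto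
  with \<psi> show ?thesis by (intro that[of \<psi>]) auto
qed

text \<open>Scaling reduces the nonzero case to norm one. Without the constraint, perturbations of a
  minimizer can be tested without renormalizing.\<close>

lemma first_eigenvalue_le: "first_eigenvalue E w r \<alpha> \<phi> * vnorm_sq w r \<psi> \<le> rayleigh \<phi> \<psi>"
proof (cases "\<psi> = (\<lambda>i. 0)")
  case True
  then show ?thesis by (simp add: rayleigh_zero vnorm_sq_eq_0[THEN iffD2])
next
  case False
  define c where "c = vnorm_sq w r \<psi>"
  have "c > 0"
    using False vnorm_sq_nonneg[of \<psi>] vnorm_sq_eq_0[of \<psi>] by (auto simp: c_def less_le)
  then have "vnorm_sq w r (\<lambda>i. (1 / sqrt c) * \<psi> i) = 1"
    unfolding vnorm_sq_scale by (simp add: c_def[symmetric] power_divide)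
  then have "first_eigenvalue E w r \<alpha> \<phi> \<le> rayleigh \<phi> (\<lambda>i. (1 / sqrt c) * \<psi> i)"
    using first_eigenvalue_attained[of \<phi>] by metis
  then show ?thesis
    using \<open>c > 0\<close> unfolding rayleigh_scale c_def[symmetric] by (simp add: power_divide field_simps)
qed

text \<open>The form \<open>rayleigh\<close> minus the eigenvalue times \<open>vnorm_sq\<close> is
  nonnegative and vanishes at \<psi>, so its first variation there vanishes in every
  direction.\<close>

lemma minimizer_imp_eigenvector:
  assumes "rayleigh \<phi> \<psi> = first_eigenvalue E w r \<alpha> \<phi> * vnorm_sq w r \<psi>"
  shows "schroedinger \<phi> \<psi> i = first_eigenvalue E w r \<alpha> \<phi> * \<psi> i"
proof -
  define \<mu> where "\<mu> = first_eigenvalue E w r \<alpha> \<phi>"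
  \<comment> \<open>A perturbation at the single vertex \<open>i\<close> collapses the first
    variation to the one term \<open>b\<close>.\<close>
  define \<eta> :: "'v \<Rightarrow> real" where "\<eta> = (\<lambda>j. if j = i then 1 else 0)"
  define b where "b = mass i * schroedinger \<phi> \<psi> i - \<mu> * (mass i * \<psi> i)"
  have "0 \<le> 2 * t * b + t\<^sup>2 * (rayleigh \<phi> \<eta> - \<mu> * vnorm_sq w r \<eta>)" for t
    using first_eigenvalue_le[of \<phi> "\<lambda>i. \<psi> i + t * \<eta> i"] assms
    unfolding rayleigh_add vnorm_sq_add \<mu>_def[symmetric] b_def
    by (simp add: \<eta>_def if_distrib[of "\<lambda>x. _ * x"] cong: if_cong) (simp add: algebra_simps)
  then have "b = 0" by (rule quadratic_nonneg_imp_linear_zero)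
  then have "mass i * (schroedinger \<phi> \<psi> i - \<mu> * \<psi> i) = 0"
    by (simp add: b_def algebra_simps)
  then show ?thesis using mass_pos[of i] by (simp add: \<mu>_def)
qed

lemma eigenvector_rayleigh:
  assumes "\<And>i. schroedinger \<phi> \<psi> i = \<mu> * \<psi> i"
  shows "rayleigh \<phi> \<psi> = \<mu> * vnorm_sq w r \<psi>"
proof -
  \<comment> \<open>Expanding the form along \<psi> itself with \<open>t = -1\<close> evaluates it
    through the pairing of \<psi> with its own image under the operator.\<close>
  have "0 = rayleigh \<phi> (\<lambda>i. \<psi> i + (-1) * \<psi> i)"
    by (simp add: rayleigh_zero)
  also have "\<dots> = 2 * rayleigh \<phi> \<psi> - 2 * (\<Sum>i\<in>UNIV. mass i * schroedinger \<phi> \<psi> i * \<psi> i)"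
    unfolding rayleigh_add by simp
  also have "(\<Sum>i\<in>UNIV. mass i * schroedinger \<phi> \<psi> i * \<psi> i) = \<mu> * vnorm_sq w r \<psi>"
    unfolding assms vnorm_sq_def sum_distrib_left
    by (intro sum.cong refl) (simp add: power2_eq_square)
  finally show ?thesis by simp
qed

section \<open>Maximum principle, positivity and uniqueness of the first eigenfunction\<close>

lemma nonneg_eigenvector_vanishes:
  assumes eq: "\<And>i. laplacian w r \<psi> i = c i * \<psi> i" and nonneg: "\<And>i. 0 \<le> \<psi> i" and zero: "\<psi> u = 0"
  shows "\<psi> v = 0"
proof -
  \<comment> \<open>At a zero of \<psi> the equation forces the weighted sum over the neighbours to
    vanish, whatever \<open>c\<close> is. Its terms are nonnegative, so the zero spreads along every
    edge of positive weight.\<close>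
  have step: "\<psi> j = 0" if "\<psi> i = 0" "0 < w i j" for i j
  proof -
    have "wdegree w i powr (- r) * (\<Sum>j\<in>UNIV. w i j * \<psi> j) = 0"
      using eq[of i] that(1) by (simp add: laplacian_def)
    then have "(\<Sum>j\<in>UNIV. w i j * \<psi> j) = 0"
      using degree_pos[of i] by simp
    then have "w i j * \<psi> j = 0"
      by (subst (asm) sum_nonneg_eq_0_iff) (auto simp: w_nonneg nonneg)
    with that(2) show ?thesis by simp
  qed
  have "(u, v) \<in> {(i, j). 0 < w i j}\<^sup>*"
    using connected by (simp add: weight_connected_def)
  then show ?thesis
    by (induction rule: rtrancl_induct) (auto simp: zero step)
qed

text \<open>The reverse triangle inequality handles each gradient term; the potential term sees only
  squares.\<close>

lemma rayleigh_abs_le: "rayleigh \<phi> (\<lambda>i. \<bar>\<psi> i\<bar>) \<le> rayleigh \<phi> \<psi>"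
proof -
  have "(\<bar>a\<bar> - \<bar>b\<bar>)\<^sup>2 \<le> (a - b)\<^sup>2" for a b :: real
    by (rule abs_le_square_iff[THEN iffD1]) linarith
  then have "grad_norm_sq E w (\<lambda>i. \<bar>\<psi> i\<bar>) \<le> grad_norm_sq E w \<psi>"
    unfolding grad_norm_sq_alt by (intro divide_right_mono sum_mono mult_left_mono) (auto simp: w_nonneg)
  then show ?thesis by (simp add: rayleigh_def weighted_vnorm_sq_def)
qed

text \<open>The absolute value of a minimizer is again a minimizer, hence an eigenvector, and a
  single zero would make it vanish identically by the maximum principle.\<close>

lemma first_eigenfunction_exists: "\<exists>\<psi>. is_first_eigenfunction E w r \<alpha> \<phi> \<psi>"
proof -
  obtain \<eta> where \<eta>: "vnorm_sq w r \<eta> = 1" "rayleigh \<phi> \<eta> = first_eigenvalue E w r \<alpha> \<phi>"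
    using first_eigenvalue_attained[of \<phi>] by metis
  define \<psi> where "\<psi> = (\<lambda>i. \<bar>\<eta> i\<bar>)"
  have norm: "vnorm_sq w r \<psi> = 1" using \<eta>(1) by (simp add: \<psi>_def vnorm_sq_def)
  have "rayleigh \<phi> \<psi> = first_eigenvalue E w r \<alpha> \<phi> * vnorm_sq w r \<psi>"
    using first_eigenvalue_le[of \<phi> \<psi>] rayleigh_abs_le[of \<phi> \<eta>] \<eta> norm by (simp add: \<psi>_def)
  then have eq: "schroedinger \<phi> \<psi> i = first_eigenvalue E w r \<alpha> \<phi> * \<psi> i" for i
    by (rule minimizer_imp_eigenvector)
  have "\<psi> i > 0" for i
  proof (rule ccontr)
    assume "\<not> \<psi> i > 0"
    then have "\<psi> i = 0" by (simp add: \<psi>_def)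
    moreover have "laplacian w r \<psi> j = (first_eigenvalue E w r \<alpha> \<phi> - \<alpha> * (1 - \<phi> j)) * \<psi> j" for j
      using eq[of j] by (simp add: algebra_simps)
    ultimately have "\<psi> = (\<lambda>i. 0)"
      using nonneg_eigenvector_vanishes[of \<psi> _ i] by (fastforce simp: \<psi>_def)
    with norm show False by (simp add: vnorm_sq_eq_0[THEN iffD2])
  qed
  with eq norm show ?thesis unfolding is_first_eigenfunction_def by blast
qed

text \<open>A touching argument shows that two positive eigenvectors are proportional; the
  normalization then fixes the factor.\<close>

lemma first_eigenfunction_unique:
  assumes "is_first_eigenfunction E w r \<alpha> \<phi> \<psi>" and "is_first_eigenfunction E w r \<alpha> \<phi> \<eta>"
  shows "\<psi> = \<eta>"
proof -
  define \<mu> where "\<mu> = first_eigenvalue E w r \<alpha> \<phi>"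
  have \<psi>: "\<And>i. schroedinger \<phi> \<psi> i = \<mu> * \<psi> i" "\<And>i. 0 < \<psi> i" "vnorm_sq w r \<psi> = 1"
    and \<eta>: "\<And>i. schroedinger \<phi> \<eta> i = \<mu> * \<eta> i" "\<And>i. 0 < \<eta> i" "vnorm_sq w r \<eta> = 1"
    using assms by (auto simp: is_first_eigenfunction_def \<mu>_def)
  \<comment> \<open>This is the largest \<open>t\<close> for which
    \<open>t * \<eta> i \<le> \<psi> i\<close> at every vertex, so the difference \<xi> is
    nonnegative and has a zero where the minimum is attained.\<close>
  define t where "t = Min (range (\<lambda>i. \<psi> i / \<eta> i))"
  define \<xi> where "\<xi> = (\<lambda>i. \<psi> i - t * \<eta> i)"
  have "t \<in> range (\<lambda>i. \<psi> i / \<eta> i)" unfolding t_def by (rule Min_in) auto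
  then obtain u where u: "t = \<psi> u / \<eta> u" by blast
  have "t > 0" using \<psi>(2) \<eta>(2) by (simp add: u)
  have "t \<le> \<psi> i / \<eta> i" for i unfolding t_def by (rule Min_le) auto
  then have "t * \<eta> i \<le> \<psi> i" for i using \<eta>(2)[of i] pos_le_divide_eq by blast
  then have "0 \<le> \<xi> i" for i by (simp add: \<xi>_def)
  moreover have "\<xi> u = 0" using \<eta>(2)[of u] by (simp add: \<xi>_def u)
  moreover have "laplacian w r \<xi> i = (\<mu> - \<alpha> * (1 - \<phi> i)) * \<xi> i" for i
  proof -
    have "laplacian w r \<xi> i = laplacian w r \<psi> i - t * laplacian w r \<eta> i"
      by (simp add: laplacian_def \<xi>_def algebra_simps sum_subtractf sum_distrib_left)
    also have "\<dots> = (\<mu> * \<psi> i - \<alpha> * (1 - \<phi> i) * \<psi> i) - t * (\<mu> * \<eta> i - \<alpha> * (1 - \<phi> i) * \<eta> i)"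
      unfolding \<psi>(1)[symmetric] \<eta>(1)[symmetric] by simp
    finally show ?thesis by (simp add: \<xi>_def algebra_simps)
  qed
  ultimately have "\<xi> i = 0" for i
    using nonneg_eigenvector_vanishes[of \<xi> "\<lambda>i. \<mu> - \<alpha> * (1 - \<phi> i)" u i] by blast
  then have eq: "\<psi> = (\<lambda>i. t * \<eta> i)" by (auto simp: \<xi>_def fun_eq_iff)
  then have "t\<^sup>2 = 1" using \<psi>(3) \<eta>(3) by (simp add: vnorm_sq_scale)
  then have "t = 1" using \<open>t > 0\<close> by (simp add: power2_eq_1_iff)
  with eq show ?thesis by simp
qed

lemma is_first_eigenfunction_first_eigenfunction:
  "is_first_eigenfunction E w r \<alpha> \<phi> (first_eigenfunction E w r \<alpha> \<phi>)"
  unfolding first_eigenfunction_def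
  by (rule theI'[of "is_first_eigenfunction E w r \<alpha> \<phi>"])
    (blast intro: first_eigenfunction_exists first_eigenfunction_unique)

section \<open>Comparing two potentials through one eigenfunction\<close>

lemma rayleigh_change_potential:
  "rayleigh \<phi>' \<psi> = rayleigh \<phi> \<psi> + \<alpha> * (\<Sum>v\<in>UNIV. mass v * ((\<phi> v - \<phi>' v) * (\<psi> v)\<^sup>2))"
proof -
  have "weighted_vnorm_sq w r (\<lambda>i. 1 - \<phi>' i) \<psi> = weighted_vnorm_sq w r (\<lambda>i. 1 - \<phi> i) \<psi>
      + (\<Sum>v\<in>UNIV. mass v * ((\<phi> v - \<phi>' v) * (\<psi> v)\<^sup>2))"
    unfolding weighted_vnorm_sq_def sum.distrib[symmetric]
    by (intro sum.cong refl) (simp add: algebra_simps)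
  then show ?thesis by (simp add: rayleigh_def algebra_simps)
qed

text \<open>Subtracting the two eigenvalue equations cancels the Laplacian, and positivity allows
  division by \<open>\<psi> v\<close>. The point is that the right-hand side does not depend on
  \<open>v\<close>.\<close>

lemma shared_minimizer_imp_constant_difference:
  assumes "0 < \<alpha>" and "is_first_eigenfunction E w r \<alpha> \<phi> \<psi>"
    and "rayleigh \<phi>' \<psi> = first_eigenvalue E w r \<alpha> \<phi>'"
  shows "\<phi> v - \<phi>' v = (first_eigenvalue E w r \<alpha> \<phi>' - first_eigenvalue E w r \<alpha> \<phi>) / \<alpha>"
proof -
  have "vnorm_sq w r \<psi> = 1" and pos: "0 < \<psi> v"
    and old: "schroedinger \<phi> \<psi> v = first_eigenvalue E w r \<alpha> \<phi> * \<psi> v"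
    using assms(2) by (auto simp: is_first_eigenfunction_def)
  then have new: "schroedinger \<phi>' \<psi> v = first_eigenvalue E w r \<alpha> \<phi>' * \<psi> v"
    using assms(3) by (intro minimizer_imp_eigenvector) simp
  have "(\<alpha> * (\<phi> v - \<phi>' v)) * \<psi> v = schroedinger \<phi>' \<psi> v - schroedinger \<phi> \<psi> v"
    by (simp add: algebra_simps)
  also have "\<dots> = (first_eigenvalue E w r \<alpha> \<phi>' - first_eigenvalue E w r \<alpha> \<phi>) * \<psi> v"
    unfolding old new by (simp add: algebra_simps)
  finally have "\<alpha> * (\<phi> v - \<phi>' v) = first_eigenvalue E w r \<alpha> \<phi>' - first_eigenvalue E w r \<alpha> \<phi>"
    using pos by simp
  then show ?thesis using assms(1) by (simp add: field_simps)
qed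

end

section \<open>Labels and tie-breaking\<close>

lemma rearrangement_label_arg_max:
  assumes "tie_breaking \<tau>" and "0 < k"
  shows "rearrangement_label E w r \<alpha> k \<tau> \<phi> v \<in> {1..k}"
    and "j \<in> {1..k} \<Longrightarrow> first_eigenfunction E w r \<alpha> (\<phi> j) v
    \<le> first_eigenfunction E w r \<alpha> (\<phi> (rearrangement_label E w r \<alpha> k \<tau> \<phi> v)) v"
proof -
  define \<psi> where "\<psi> = (\<lambda>j. first_eigenfunction E w r \<alpha> (\<phi> j))"
  let ?S = "{i. is_arg_max (\<lambda>j. \<psi> j v) (\<lambda>j. j \<in> {1..k}) i}"
  \<comment> \<open>A maximizer has to be exhibited, because \<open>tie_breaking\<close> constrains
    \<tau> only on nonempty sets.\<close>
  have "finite ((\<lambda>j. \<psi> j v) ` {1..k})" "(\<lambda>j. \<psi> j v) ` {1..k} \<noteq> {}"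
    using assms(2) by auto
  then have "Max ((\<lambda>j. \<psi> j v) ` {1..k}) \<in> (\<lambda>j. \<psi> j v) ` {1..k}"
    by (rule Max_in)
  then obtain i where "i \<in> {1..k}" "\<psi> i v = Max ((\<lambda>j. \<psi> j v) ` {1..k})" by auto
  then have "i \<in> ?S" by (auto simp: is_arg_max_linorder)
  then have "?S \<noteq> {}" by blast
  then have "\<tau> v ?S \<in> ?S" using assms(1)[unfolded tie_breaking_def, rule_format] by blast
  then have mem: "rearrangement_label E w r \<alpha> k \<tau> \<phi> v \<in> ?S"
    by (simp add: rearrangement_label_def \<psi>_def)
  then show "rearrangement_label E w r \<alpha> k \<tau> \<phi> v \<in> {1..k}"
    by (simp add: is_arg_max_def)
  show "j \<in> {1..k} \<Longrightarrow> first_eigenfunction E w r \<alpha> (\<phi> j) v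
    \<le> first_eigenfunction E w r \<alpha> (\<phi> (rearrangement_label E w r \<alpha> k \<tau> \<phi> v)) v"
    using mem by (auto simp: is_arg_max_linorder \<psi>_def)
qed

text \<open>Both collections sum to one at each vertex, so the constants \<open>c i\<close> sum to
  zero, and a nonzero one entails a negative one.\<close>

lemma indicator_constant_difference:
  fixes \<phi> :: "nat \<Rightarrow> 'v::finite \<Rightarrow> real" and l :: "'v \<Rightarrow> nat"
  assumes "admissible k \<phi>" and labels: "\<And>v. l v \<in> {1..k}"
    and diff: "\<And>i v. i \<in> {1..k} \<Longrightarrow> \<phi> i v - indicator {v. l v = i} v = c i"
    and "i \<in> {1..k}" and "c i \<noteq> 0"
  shows "all_constant k \<phi> \<and> all_constant k (\<lambda>i. indicator {v. l v = i} :: 'v \<Rightarrow> real)"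
proof -
  have bounds: "0 \<le> \<phi> i v" "\<phi> i v \<le> 1" if "i \<in> {1..k}" for i v
    using assms(1) that by (auto simp: admissible_def)
  have sum_c: "(\<Sum>i=1..k. c i) = 0"
  proof -
    fix v
    have "(\<Sum>i=1..k. c i) = (\<Sum>i=1..k. \<phi> i v - indicator {v. l v = i} v)"
      using diff by (intro sum.cong) auto
    also have "\<dots> = (\<Sum>i=1..k. \<phi> i v) - (\<Sum>i=1..k. if i = l v then 1 else 0)"
      unfolding sum_subtractf by (intro arg_cong2[where f = "(-)"] sum.cong) auto
    also have "\<dots> = 0"
      using assms(1) labels[of v] by (simp add: admissible_def)
    finally show ?thesis .
  qed
  have "\<exists>j\<in>{1..k}. c j < 0"
  proof (rule ccontr)
    assume "\<not> (\<exists>j\<in>{1..k}. c j < 0)"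
    then have "\<forall>j\<in>{1..k}. c j = 0"
      using sum_c by (subst (asm) sum_nonneg_eq_0_iff) (auto simp: not_less)
    with assms(4,5) show False by blast
  qed
  then obtain j where j: "j \<in> {1..k}" "c j < 0" by blast
  \<comment> \<open>At a vertex with another label the indicator is zero, and
    \<open>\<phi> j v\<close> would equal the negative number \<open>c j\<close>.\<close>
  have l: "l v = j" for v
  proof (rule ccontr)
    assume "l v \<noteq> j"
    with diff[OF j(1), of v] bounds(1)[OF j(1), of v] j(2) show False by simp
  qed
  have "all_constant k (\<lambda>i. indicator {v. l v = i} :: 'v \<Rightarrow> real)"
    by (simp add: all_constant_def l indicator_def)
  moreover have "\<phi> i u = \<phi> i v" if "i \<in> {1..k}" for i u v
    using diff[OF that, of u] diff[OF that, of v] by (auto simp: l indicator_def split: if_splits)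
  ultimately show ?thesis by (simp add: all_constant_def)
qed

section \<open>Strict decrease in one iteration\<close>

theorem lemma3p4:
  fixes E :: "('v::finite \<times> 'v) set" and w :: "'v \<Rightarrow> 'v \<Rightarrow> real"
    and r \<alpha> :: real and k :: nat
    and \<tau> :: "'v \<Rightarrow> nat set \<Rightarrow> nat"
    and \<phi> :: "nat \<Rightarrow> 'v \<Rightarrow> real"
  assumes "weighted_graph E w" and "weight_connected w"
    and "0 \<le> r" and "r \<le> 1" and "0 < \<alpha>" and "0 < k"
    and "tie_breaking \<tau>"
    and "admissible k \<phi>"
    and "\<not> fixed_by_rearrangement E w r \<alpha> k \<tau> \<phi>"
    and "\<not> degenerate_tie E w r \<alpha> k \<tau> \<phi>"
  shows "relaxed_energy E w r \<alpha> k (rearrangement E w r \<alpha> k \<tau> \<phi>) < relaxed_energy E w r \<alpha> k \<phi>"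
proof -
  \<comment> \<open>The degree of the vertex of a one-vertex graph may vanish, but there everything is constant.\<close>
  obtain u v :: 'v where "u \<noteq> v"
    using assms(10) unfolding degenerate_tie_def all_constant_def by metis
  then interpret positive_degree_graph E w r \<alpha>
    using assms(1,2) wdegree_pos[OF assms(1,2)] by unfold_locales
  define \<psi> where "\<psi> = (\<lambda>i. first_eigenfunction E w r \<alpha> (\<phi> i))"
  define l where "l = rearrangement_label E w r \<alpha> k \<tau> \<phi>"
  define \<phi>' :: "nat \<Rightarrow> 'v \<Rightarrow> real" where "\<phi>' = (\<lambda>i. indicator {v. l v = i})"
  let ?\<mu> = "first_eigenvalue E w r \<alpha>"
  have \<phi>'_eq: "rearrangement E w r \<alpha> k \<tau> \<phi> = \<phi>'"
    by (simp add: fun_eq_iff rearrangement_def \<phi>'_def l_def)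
  have \<psi>: "is_first_eigenfunction E w r \<alpha> (\<phi> i) (\<psi> i)" for i
    unfolding \<psi>_def by (rule is_first_eigenfunction_first_eigenfunction)
  then have pos: "0 < \<psi> i v" and norm: "vnorm_sq w r (\<psi> i) = 1" for i v
    by (auto simp: is_first_eigenfunction_def)
  have "rayleigh (\<phi> i) (\<psi> i) = ?\<mu> (\<phi> i) * vnorm_sq w r (\<psi> i)" for i
    using \<psi>[of i] by (intro eigenvector_rayleigh) (simp add: is_first_eigenfunction_def)
  then have old: "rayleigh (\<phi> i) (\<psi> i) = ?\<mu> (\<phi> i)" for i
    by (simp add: norm)
  have test: "?\<mu> (\<phi>' i) \<le> rayleigh (\<phi>' i) (\<psi> i)" for i
    using first_eigenvalue_le[of "\<phi>' i" "\<psi> i"] by (simp add: norm)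
  have l_mem: "l v \<in> {1..k}" and l_max: "j \<in> {1..k} \<Longrightarrow> \<psi> j v \<le> \<psi> (l v) v" for j v
    using rearrangement_label_arg_max[OF assms(7,6)] by (auto simp: l_def \<psi>_def)
  have change: "(\<Sum>i=1..k. (\<phi> i v - \<phi>' i v) * (\<psi> i v)\<^sup>2) \<le> 0" for v
  proof -
    \<comment> \<open>At a fixed vertex the \<open>\<phi> i v\<close> are convex weights, and an
      average of squares is at most the largest square. Positivity of the eigenfunctions carries
      their order over to the squares.\<close>
    have "(\<Sum>i=1..k. \<phi> i v * (\<psi> i v)\<^sup>2) \<le> (\<Sum>i=1..k. \<phi> i v * (\<psi> (l v) v)\<^sup>2)"
      using assms(8) pos l_max
      by (intro sum_mono mult_left_mono power_mono) (auto simp: admissible_def less_imp_le)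
    also have "\<dots> = (\<psi> (l v) v)\<^sup>2"
      using assms(8) by (simp add: admissible_def sum_distrib_right[symmetric])
    also have "\<dots> = (\<Sum>i=1..k. if i = l v then (\<psi> i v)\<^sup>2 else 0)"
      using l_mem[of v] by simp
    also have "\<dots> = (\<Sum>i=1..k. \<phi>' i v * (\<psi> i v)\<^sup>2)"
      by (intro sum.cong) (auto simp: \<phi>'_def)
    finally show ?thesis by (simp add: left_diff_distrib sum_subtractf)
  qed
  have "(\<Sum>i=1..k. rayleigh (\<phi>' i) (\<psi> i))
      = (\<Sum>i=1..k. ?\<mu> (\<phi> i)) + \<alpha> * (\<Sum>i=1..k. \<Sum>v\<in>UNIV. mass v * ((\<phi> i v - \<phi>' i v) * (\<psi> i v)\<^sup>2))"
    unfolding sum_distrib_left[of \<alpha>] sum.distrib[symmetric]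
    by (intro sum.cong refl)
      (simp only: rayleigh_change_potential[where \<phi> = "\<phi> i" and \<phi>' = "\<phi>' i" for i] old sum_distrib_left)
  \<comment> \<open>Summing over labels first makes the vertexwise bound \<open>change\<close>
    applicable.\<close>
  also have "(\<Sum>i=1..k. \<Sum>v\<in>UNIV. mass v * ((\<phi> i v - \<phi>' i v) * (\<psi> i v)\<^sup>2))
      = (\<Sum>v\<in>UNIV. mass v * (\<Sum>i=1..k. (\<phi> i v - \<phi>' i v) * (\<psi> i v)\<^sup>2))"
    unfolding sum_distrib_left by (rule sum.swap)
  also have "\<dots> \<le> 0"
    using change by (intro sum_nonpos) (simp add: mult_nonneg_nonpos)
  finally have upper: "(\<Sum>i=1..k. rayleigh (\<phi>' i) (\<psi> i)) \<le> (\<Sum>i=1..k. ?\<mu> (\<phi> i))"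
    using assms(5) by (simp add: mult_left_mono)
  \<comment> \<open>The facts \<open>test\<close> and \<open>upper\<close> already give the weak
    inequality; strictness only requires one old eigenfunction that fails to minimize for its new
    potential.\<close>
  have "\<exists>i\<in>{1..k}. ?\<mu> (\<phi>' i) < rayleigh (\<phi>' i) (\<psi> i)"
  proof (rule ccontr)
    assume no_gap: "\<not> ?thesis"
    have "rayleigh (\<phi>' i) (\<psi> i) = ?\<mu> (\<phi>' i)" if "i \<in> {1..k}" for i
      using no_gap test[of i] that by (auto simp: not_less intro: order_antisym)
    then have diff: "\<phi> i v - \<phi>' i v = (?\<mu> (\<phi>' i) - ?\<mu> (\<phi> i)) / \<alpha>" if "i \<in> {1..k}" for i v
      using shared_minimizer_imp_constant_difference[OF assms(5) \<psi>] that by blast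
    obtain i v where iv: "i \<in> {1..k}" "\<phi>' i v \<noteq> \<phi> i v"
      using assms(9) unfolding fixed_by_rearrangement_def \<phi>'_eq by blast
    have "all_constant k \<phi> \<and> all_constant k \<phi>'"
      unfolding \<phi>'_def
    proof (rule indicator_constant_difference[OF assms(8) l_mem])
      show "\<phi> j u - indicator {v. l v = j} u = (?\<mu> (\<phi>' j) - ?\<mu> (\<phi> j)) / \<alpha>" if "j \<in> {1..k}" for j u
        using diff[OF that, of u] by (simp add: \<phi>'_def)
      show "(?\<mu> (\<phi>' i) - ?\<mu> (\<phi> i)) / \<alpha> \<noteq> 0"
        using diff[OF iv(1), of v] iv(2) by linarith
    qed (rule iv(1))
    with assms(10) show False by (simp add: degenerate_tie_def \<phi>'_eq)
  qed
  then have "(\<Sum>i=1..k. ?\<mu> (\<phi>' i)) < (\<Sum>i=1..k. rayleigh (\<phi>' i) (\<psi> i))"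
    using test by (intro sum_strict_mono_ex1) auto
  with upper show ?thesis by (simp add: relaxed_energy_def \<phi>'_eq)
qed

end
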